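(* Let $\mathfrak g$ and $V$ be $n$-Lie algebras and let $(\rho_V,\vartheta_V,\omega)$ be a sparse crossed system, i.e. linear maps $\rho_V:\bigwedge^{n-1}V\to\mathrm{End}(\mathfrak g)$, $\vartheta_V:V\to\mathrm{Hom}(\bigwedge^{n-1}\mathfrak g,\mathfrak g)$, $\omega:\bigwedge^nV\to\mathfrak g$. Put $$\begin{aligned}\mathcal C(x_1,u_1;\dots;x_n,u_n)={}&[x_1,\dots,x_n]_{\mathfrak g}+\omega(u_1,\dots,u_n)+\sum_{i=1}^n(-1)^{i-1}\vartheta_V(u_i)(x_1,\dots,\widehat{x_i},\dots,x_n)\\&+\sum_{i=1}^n(-1)^{n-i}\rho_V(u_1,\dots,\widehat{u_i},\dots,u_n)x_i\end{aligned}$$ for $x_i\in\mathfrak g,u_i\in V$. Then the operation $$[x_1+u_1,\dots,x_n+u_n]=\mathcal C(x_1,u_1;\dots;x_n,u_n)+[u_1,\dots,u_n]_V$$ on $\mathfrak g\oplus V$ is an $n$-Lie bracket if and only if for all $x_1,\dots,x_{n-1},y_1,\dots,y_n\in\mathfrak g$ and $u_1,\dots,u_{n-1},v_1,\dots,v_n\in V$ $$\mathcal C(x_1,u_1;\dots;x_{n-1},u_{n-1};\mathcal C_0,\mathcal V_0)=\sum_{i=1}^n\mathcal C(y_1,v_1;\dots;y_{i-1},v_{i-1};\mathcal C_i,\mathcal V_i;y_{i+1},v_{i+1};\dots;y_n,v_n),$$ where $\mathcal C_0=\mathcal C(y_1,v_1;\dots;y_n,v_n)$, $\mathcal V_0=[v_1,\dots,v_n]_V$,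 and for $1\le i\le n$, $\mathcal C_i=\mathcal C(x_1,u_1;\dots;x_{n-1},u_{n-1};y_i,v_i)$, $\mathcal V_i=[u_1,\dots,u_{n-1},v_i]_V$.
   Context: $K$ is a field of characteristic zero; vector spaces are over $K$, all maps are linear; $n\ge2$; a hat denotes omission. An $n$-Lie algebra is a vector space with an alternating $n$-linear bracket (an $n$-Lie bracket) satisfying $[z_1,\dots,z_{n-1},[w_1,\dots,w_n]]=\sum_{i=1}^n[w_1,\dots,w_{i-1},[z_1,\dots,z_{n-1},w_i],w_{i+1},\dots,w_n]$. Brackets of $\mathfrak g$ and $V$ are denoted $[-,\dots,-]_{\mathfrak g}$ and $[-,\dots,-]_V$. *)

theory Defs
  imports "HOL-Analysis.Product_Vector"
begin

text \<open>
  An \<open>m\<close>-tuple is a list of length \<open>m\<close>, so maps of \<open>m\<close> arguments are functions on lists whose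
  values on lists of other lengths are irrelevant. List positions are counted from \<open>0\<close>: the
  argument with index \<open>i\<close> in the mathematical notation is at position \<open>i - 1\<close>.
  Linear maps out of an exterior power \<open>\<Lambda>\<^sup>m\<close> are the alternating \<open>m\<close>-linear maps.
\<close>

definition alternating_multilinear ::
  "('k::field \<Rightarrow> 'a::ab_group_add \<Rightarrow> 'a) \<Rightarrow> ('k \<Rightarrow> 'b::ab_group_add \<Rightarrow> 'b) \<Rightarrow> nat \<Rightarrow> ('a list \<Rightarrow> 'b) \<Rightarrow> bool"
  where
  "alternating_multilinear sa sb m f \<longleftrightarrow>
     (\<forall>xs i. length xs = m \<longrightarrow> i < m \<longrightarrow> Vector_Spaces.linear sa sb (\<lambda>x. f (xs[i := x]))) \<and>
     (\<forall>xs i j. length xs = m \<longrightarrow> i < j \<longrightarrow> j < m \<longrightarrow> xs ! i = xs ! j \<longrightarrow> f xs = 0)"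

definition n_lie_bracket ::
  "('k::field \<Rightarrow> 'a::ab_group_add \<Rightarrow> 'a) \<Rightarrow> nat \<Rightarrow> ('a list \<Rightarrow> 'a) \<Rightarrow> bool"
  where
  "n_lie_bracket s n br \<longleftrightarrow>
     alternating_multilinear s s n br \<and>
     (\<forall>zs ws. length zs = n - 1 \<longrightarrow> length ws = n \<longrightarrow>
        br (zs @ [br ws]) = (\<Sum>i<n. br (ws[i := br (zs @ [ws ! i])])))"

locale n_lie_algebra = vector_space scale
  for scale :: "'k::field_char_0 \<Rightarrow> 'a::ab_group_add \<Rightarrow> 'a" +
  fixes n :: nat and bracket :: "'a list \<Rightarrow> 'a"
  assumes n_ge_2: "n \<ge> 2"
    and n_lie_bracket: "n_lie_bracket scale n bracket"

locale sparse_crossed_system =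
  g: n_lie_algebra sg n brg + V: n_lie_algebra sV n brV
  for sg :: "'k::field_char_0 \<Rightarrow> 'g::ab_group_add \<Rightarrow> 'g"
    and sV :: "'k \<Rightarrow> 'v::ab_group_add \<Rightarrow> 'v"
    and n :: nat
    and brg :: "'g list \<Rightarrow> 'g"
    and brV :: "'v list \<Rightarrow> 'v" +
  fixes \<rho> :: "'v list \<Rightarrow> 'g \<Rightarrow> 'g"
    and \<theta> :: "'v \<Rightarrow> 'g list \<Rightarrow> 'g"
    and \<omega> :: "'v list \<Rightarrow> 'g"
  assumes rho_End: "\<And>us. length us = n - 1 \<Longrightarrow> Vector_Spaces.linear sg sg (\<rho> us)"
    and rho_alternating: "\<And>x. alternating_multilinear sV sg (n - 1) (\<lambda>us. \<rho> us x)"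
    and theta_linear: "\<And>xs. length xs = n - 1 \<Longrightarrow> Vector_Spaces.linear sV sg (\<lambda>u. \<theta> u xs)"
    and theta_alternating: "\<And>u. alternating_multilinear sg sg (n - 1) (\<theta> u)"
    and omega_alternating: "alternating_multilinear sV sg n \<omega>"

definition omit_nth :: "nat \<Rightarrow> 'a list \<Rightarrow> 'a list"
  where "omit_nth i xs = take i xs @ drop (Suc i) xs"

text \<open>
  The value \<open>\<C>(x\<^sub>1,u\<^sub>1; \<dots>; x\<^sub>n,u\<^sub>n)\<close>, with \<open>xs\<close> and \<open>us\<close> the lists of the \<open>x\<^sub>i\<close> and of the \<open>u\<^sub>i\<close>.
  As positions start at \<open>0\<close>, the signs \<open>(-1)\<^bsup>i-1\<^esup>\<close> and \<open>(-1)\<^bsup>n-i\<^esup>\<close> become \<open>(-1)\<^bsup>i\<^esup>\<close> and \<open>(-1)\<^bsup>n-1-i\<^esup>\<close>.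
\<close>

definition crossed_map ::
  "('k::field \<Rightarrow> 'g::ab_group_add \<Rightarrow> 'g) \<Rightarrow> nat \<Rightarrow> ('g list \<Rightarrow> 'g) \<Rightarrow> ('v list \<Rightarrow> 'g \<Rightarrow> 'g) \<Rightarrow>
   ('v \<Rightarrow> 'g list \<Rightarrow> 'g) \<Rightarrow> ('v list \<Rightarrow> 'g) \<Rightarrow> 'g list \<Rightarrow> 'v list \<Rightarrow> 'g"
  where
  "crossed_map sg n brg \<rho> \<theta> \<omega> xs us =
     brg xs + \<omega> us
     + (\<Sum>i<n. sg ((-1) ^ i) (\<theta> (us ! i) (omit_nth i xs)))
     + (\<Sum>i<n. sg ((-1) ^ (n - 1 - i)) (\<rho> (omit_nth i us) (xs ! i)))"

end

theory Submission
  imports Defs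
begin

text \<open>
  The bracket on \<open>\<gg> \<oplus> V\<close> has two components. For the fundamental identity, its \<open>V\<close>-component is
  the fundamental identity of \<open>V\<close>, which holds, and its \<open>\<gg>\<close>-component is word for word the
  asserted equation for \<open>\<C>\<close>, because an \<open>m\<close>-tuple of pairs is a pair of \<open>m\<close>-tuples. So the whole
  content of the theorem is that the bracket is always alternating and multilinear, for any
  crossed system.

  The terms \<open>[x\<^sub>1,\<dots>,x\<^sub>n]\<^sub>\<gg>\<close>, \<open>\<omega>(u\<^sub>1,\<dots>,u\<^sub>n)\<close> and \<open>[u\<^sub>1,\<dots>,u\<^sub>n]\<^sub>V\<close> are alternating maps pulled back along
  a linear projection. The two signed sums are instances of one construction: from a map
  \<open>F(z; z\<^sub>2,\<dots>,z\<^sub>n)\<close> that is linear in \<open>z\<close> and alternating in the other arguments, form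
  \<open>\<Sum>\<^sub>i (-1)\<^bsup>i-1\<^esup> F(z\<^sub>i; z\<^sub>1,\<dots>,z\<^sub>n without z\<^sub>i)\<close>. For \<open>\<theta>\<close> the distinguished argument is read in \<open>V\<close> and
  the others in \<open>\<gg>\<close>, for \<open>\<rho>\<close> the other way round, where the sign \<open>(-1)\<^bsup>n-i\<^esup>\<close> differs from
  \<open>(-1)\<^bsup>i-1\<^esup>\<close> only by the constant factor \<open>(-1)\<^bsup>n-1\<^esup>\<close>. This construction always yields an alternating
  map (\<open>alternating_multilinear_expansion\<close>): if \<open>z\<^sub>j = z\<^sub>k\<close> with \<open>j < k\<close>, every term other than the
  \<open>j\<close>th and the \<open>k\<close>th has a repeated argument, and the tuples that these two retain differ by
  moving one entry past \<open>k - j - 1\<close> others, which makes them cancel.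
\<close>

section \<open>Operations on alternating multilinear maps\<close>

lemma alternating_multilinear_linear:
  assumes "alternating_multilinear sa sb m f" "length xs = m" "i < m"
  shows "Vector_Spaces.linear sa sb (\<lambda>x. f (xs[i := x]))"
  using assms by (simp add: alternating_multilinear_def)

lemma alternating_multilinear_repeated:
  assumes "alternating_multilinear sa sb m f" "length xs = m"
    and "i < m" "j < m" "i \<noteq> j" "xs ! i = xs ! j"
  shows "f xs = 0"
  using assms unfolding alternating_multilinear_def by (metis nat_neq_iff)

lemma alternating_multilinear_comp_map:
  fixes h :: "'a::ab_group_add \<Rightarrow> 'b::ab_group_add"
  assumes f: "alternating_multilinear sb sc m f" and h: "Vector_Spaces.linear sa sb h"
  shows "alternating_multilinear sa sc m (\<lambda>zs. f (map h zs))"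
  unfolding alternating_multilinear_def
proof (intro conjI allI impI)
  fix zs :: "'a list" and i assume "length zs = m" "i < m"
  then have "Vector_Spaces.linear sb sc (\<lambda>x. f ((map h zs)[i := x]))"
    using f by (intro alternating_multilinear_linear) auto
  from Vector_Spaces.linear_compose[OF h this]
  show "Vector_Spaces.linear sa sc (\<lambda>x. f (map h (zs[i := x])))"
    by (simp add: o_def map_update)
next
  fix zs :: "'a list" and i j assume "length zs = m" "i < j" "j < m" "zs ! i = zs ! j"
  then show "f (map h zs) = 0"
    by (intro alternating_multilinear_repeated[OF f, of _ i j]) auto
qed

lemma alternating_multilinear_add:
  assumes "alternating_multilinear sa sb m f" "alternating_multilinear sa sb m g"
  shows "alternating_multilinear sa sb m (\<lambda>xs. f xs + g xs)"
  using assms unfolding alternating_multilinear_def Vector_Spaces.linear_iff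
  by (simp add: vector_space.vector_space_assms(1) algebra_simps)

lemma alternating_multilinear_scale:
  assumes "alternating_multilinear sa sb m f" and "vector_space sb"
  shows "alternating_multilinear sa sb m (\<lambda>xs. sb c (f xs))"
proof -
  interpret vector_space sb by fact
  show ?thesis
    using assms(1) unfolding alternating_multilinear_def Vector_Spaces.linear_iff
    by (simp add: scale_right_distrib scale_left_commute)
qed

lemma alternating_multilinear_Pair:
  assumes f: "alternating_multilinear sa sb m f" and g: "alternating_multilinear sa sc m g"
    and "vector_space sb" "vector_space sc"
  shows "alternating_multilinear sa (module_prod.scale sb sc) m (\<lambda>xs. (f xs, g xs))"
proof -
  interpret vector_space_prod sb sc
    using assms(3,4) by (simp add: vector_space_prod_def vector_space_pair_def)
  show ?thesis
    using f g unfolding alternating_multilinear_def Vector_Spaces.linear_iff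
    by (simp add: scale_prod zero_prod_def p.vector_space_axioms)
qed

section \<open>Moving an entry of an alternating map\<close>

text \<open>Polarization: the value vanishes when both entries are \<open>x + y\<close>, and so it does for
  \<open>x, x\<close> and \<open>y, y\<close>; of its four terms only the two mixed ones survive.\<close>

lemma alternating_multilinear_swap_adjacent:
  assumes f: "alternating_multilinear sa sb m f"
    and m: "m = length as + length cs + 2"
  shows "f (as @ x # y # cs) = - f (as @ y # x # cs)"
proof -
  have add1: "f (as @ (a + a') # b # cs) = f (as @ a # b # cs) + f (as @ a' # b # cs)" for a a' b
    using alternating_multilinear_linear[OF f, of "as @ 0 # b # cs" "length as"] m
    by (simp add: Vector_Spaces.linear_iff)
  have add2: "f (as @ b # (a + a') # cs) = f (as @ b # a # cs) + f (as @ b # a' # cs)" for a a' b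
    using alternating_multilinear_linear[OF f, of "as @ b # 0 # cs" "Suc (length as)"] m
    by (simp add: Vector_Spaces.linear_iff list_update_append)
  have diag: "f (as @ a # a # cs) = 0" for a
    by (rule alternating_multilinear_repeated[OF f, of _ "length as" "Suc (length as)"])
       (auto simp: m nth_append)
  have "f (as @ x # y # cs) + f (as @ y # x # cs) = f (as @ (x + y) # (x + y) # cs)"
    unfolding add1 add2 by (simp add: diag)
  also have "\<dots> = 0"
    by (rule diag)
  finally show ?thesis
    by (simp add: eq_neg_iff_add_eq_0)
qed

text \<open>Moving the entry \<open>z\<close> past \<open>bs\<close> is a composition of \<open>length bs\<close> adjacent swaps.\<close>

lemma alternating_multilinear_move:
  assumes f: "alternating_multilinear sa sb m f" and sb: "vector_space sb"
    and m: "m = length as + length bs + length cs + 1"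
  shows "f (as @ bs @ z # cs) = sb ((-1) ^ length bs) (f (as @ z # bs @ cs))"
  using m
proof (induction bs arbitrary: as)
  interpret vector_space sb by fact
  case Nil
  then show ?case by simp
next
  interpret vector_space sb by fact
  case (Cons b bs)
  have "f (as @ (b # bs) @ z # cs) = sb ((-1) ^ length bs) (f (as @ b # z # bs @ cs))"
    using Cons.IH[of "as @ [b]"] Cons.prems by simp
  also have "f (as @ b # z # bs @ cs) = - f (as @ z # b # bs @ cs)"
    using Cons.prems by (intro alternating_multilinear_swap_adjacent[OF f]) simp
  finally show ?case by simp
qed

section \<open>Signed expansion along one argument\<close>

lemma length_omit_nth: "i < length xs \<Longrightarrow> length (omit_nth i xs) = length xs - 1"
  by (auto simp: omit_nth_def)

lemma map_omit_nth: "map h (omit_nth i xs) = omit_nth i (map h xs)"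
  by (simp add: omit_nth_def take_map drop_map)

text \<open>Omitting position \<open>i\<close> shifts every later position down by one, whence the position
  \<open>if k < i then k else k - 1\<close> below.\<close>

lemma nth_omit_nth:
  assumes "i < length xs" "k < length xs" "k \<noteq> i"
  shows "omit_nth i xs ! (if k < i then k else k - 1) = xs ! k"
  using assms by (auto simp: omit_nth_def nth_append min_def)

lemma omit_nth_update_same: "omit_nth i (xs[i := x]) = omit_nth i xs"
  by (simp add: omit_nth_def)

lemma omit_nth_update_other:
  assumes "i < length xs" "k < length xs" "k \<noteq> i"
  shows "omit_nth i (xs[k := x]) = (omit_nth i xs)[(if k < i then k else k - 1) := x]"
  using assms
  by (cases "k < i") (auto simp: omit_nth_def list_update_append drop_update_swap
      simp flip: take_update_swap)

text \<open>Both omissions leave the common value \<open>z\<close> once: omitting position \<open>k\<close> leaves it in front of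
  the entries strictly between \<open>j\<close> and \<open>k\<close>, omitting position \<open>j\<close> leaves it behind them.\<close>

lemma alternating_multilinear_omit_repeated:
  assumes f: "alternating_multilinear sa sb m f" and sb: "vector_space sb"
    and len: "length zs = Suc m" and jk: "j < k" "k < Suc m" and eq: "zs ! j = zs ! k"
  shows "f (omit_nth j zs) = sb ((-1) ^ (k - Suc j)) (f (omit_nth k zs))"
proof -
  define as where "as = take j zs"
  define bs where "bs = take (k - Suc j) (drop (Suc j) zs)"
  define cs where "cs = drop (Suc k) zs"
  define z where "z = zs ! k"
  have "drop (Suc j) zs = bs @ drop k zs"
    using jk append_take_drop_id[of "k - Suc j" "drop (Suc j) zs"] by (simp add: bs_def)
  also have "drop k zs = z # cs"
    using jk len by (simp add: z_def cs_def Cons_nth_drop_Suc)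
  finally have tail: "drop (Suc j) zs = bs @ z # cs" .
  have zs: "zs = as @ z # bs @ z # cs"
    using id_take_nth_drop[of j zs] jk len by (simp add: as_def tail eq z_def)
  have lens: "length as = j" "length bs = k - Suc j"
    using jk len by (auto simp: as_def bs_def)
  have oj: "omit_nth j zs = as @ bs @ z # cs"
    by (simp add: omit_nth_def tail as_def)
  have "take k zs = as @ z # bs"
    by (subst zs) (use jk lens in \<open>simp add: take_Cons'\<close>)
  then have ok: "omit_nth k zs = as @ z # bs @ cs"
    by (simp add: omit_nth_def cs_def)
  have "m = length as + length bs + length cs + 1"
    using arg_cong[OF zs, of length] len by simp
  from alternating_multilinear_move[OF f sb this] show ?thesis
    by (simp add: oj ok lens)
qed

text \<open>An argument of the sum sits in the head of one term and in the tail of all the others, so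
  linearity needs both hypotheses. For \<open>zs ! j = zs ! k\<close> with \<open>j < k\<close>, only the terms \<open>j\<close> and \<open>k\<close>
  survive; the first has the sign \<open>(-1)\<^bsup>j\<^esup>\<close>, times \<open>(-1)\<^bsup>k-1-j\<^esup>\<close> for aligning its tail with that of the
  second, which makes \<open>(-1)\<^bsup>k-1\<^esup>\<close> against \<open>(-1)\<^bsup>k\<^esup>\<close>.\<close>

lemma alternating_multilinear_expansion:
  fixes sa :: "'k::field \<Rightarrow> 'a::ab_group_add \<Rightarrow> 'a"
    and sb :: "'k \<Rightarrow> 'b::ab_group_add \<Rightarrow> 'b"
  assumes head: "\<And>xs. length xs = m \<Longrightarrow> Vector_Spaces.linear sa sb (\<lambda>z. F z xs)"
    and tail: "\<And>z. alternating_multilinear sa sb m (F z)"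
  shows "alternating_multilinear sa sb (Suc m)
           (\<lambda>zs. \<Sum>i<Suc m. sb ((-1) ^ i) (F (zs ! i) (omit_nth i zs)))"
proof -
  \<comment> \<open>The head hypothesis at some tail provides the vector space axioms of both scalings.\<close>
  have "Vector_Spaces.linear sa sb (\<lambda>z. F z (replicate m 0))"
    by (rule head) simp
  then have "vector_space sa" and sb: "vector_space sb"
    by (simp_all add: Vector_Spaces.linear_iff)
  then interpret vector_space_pair sa sb
    by (simp add: vector_space_pair_def)
  show ?thesis
    unfolding alternating_multilinear_def
  proof (intro conjI allI impI)
    fix zs :: "'a list" and k assume len: "length zs = Suc m" and k: "k < Suc m"
    have "Vector_Spaces.linear sa sb (\<lambda>x. F (zs[k := x] ! i) (omit_nth i (zs[k := x])))"
      if i: "i < Suc m" for i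
    proof (cases "i = k")
      case True
      then show ?thesis
        using len k head[of "omit_nth k zs"] by (simp add: omit_nth_update_same length_omit_nth)
    next
      case False
      then show ?thesis
        using len k i alternating_multilinear_linear[OF tail,
            of "omit_nth i zs" "if k < i then k else k - 1" "zs ! i"]
        by (auto simp: omit_nth_update_other length_omit_nth)
    qed
    then show "Vector_Spaces.linear sa sb
        (\<lambda>x. \<Sum>i<Suc m. sb ((-1) ^ i) (F (zs[k := x] ! i) (omit_nth i (zs[k := x]))))"
      by (intro linear_compose_sum ballI linear_compose_scale_right) auto
  next
    fix zs :: "'a list" and j k
    assume len: "length zs = Suc m" and jk: "j < k" "k < Suc m" and eq: "zs ! j = zs ! k"
    let ?t = "\<lambda>i. sb ((-1) ^ i) (F (zs ! i) (omit_nth i zs))"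
    let ?p = "\<lambda>i l. if l < i then l else l - 1"
    have "?t i = 0" if i: "i < Suc m" "i \<noteq> j" "i \<noteq> k" for i
    proof -
      have "omit_nth i zs ! ?p i j = omit_nth i zs ! ?p i k"
        using nth_omit_nth[of i zs j] nth_omit_nth[of i zs k] i jk len eq by simp
      then have "F (zs ! i) (omit_nth i zs) = 0"
        by (intro alternating_multilinear_repeated[OF tail, of _ "?p i j" "?p i k"])
           (use i jk len in \<open>auto simp: length_omit_nth\<close>)
      then show ?thesis by simp
    qed
    then have "(\<Sum>i<Suc m. ?t i) = (\<Sum>i\<in>{j, k}. ?t i)"
      using jk by (intro sum.mono_neutral_right) auto
    also have "\<dots> = ?t j + ?t k"
      using jk by simp
    also have "?t j = sb ((-1) ^ (j + (k - Suc j))) (F (zs ! k) (omit_nth k zs))"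
      using alternating_multilinear_omit_repeated[OF tail sb len jk eq, of "zs ! j"]
      by (simp add: eq power_add)
    also have "\<dots> = - ?t k"
    proof -
      have "k = Suc (j + (k - Suc j))"
        using jk by simp
      then have "(-1 :: 'k) ^ k = - ((-1) ^ (j + (k - Suc j)))"
        by (metis power_Suc mult_minus1)
      then show ?thesis by simp
    qed
    finally show "(\<Sum>i<Suc m. ?t i) = 0" by simp
  qed
qed

section \<open>The bracket on the direct sum\<close>

context sparse_crossed_system
begin

interpretation vector_space_prod sg sV
  by unfold_locales

text \<open>The \<open>\<theta>\<close>-sum and the \<open>\<rho>\<close>-sum are signed expansions with the head read in \<open>V\<close> and in \<open>\<gg>\<close>
  respectively; pulling the constant \<open>(-1)\<^bsup>n-1\<^esup>\<close> out of the \<open>\<rho>\<close>-sum turns its signs into those of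
  an expansion.\<close>

lemma crossed_map_alternating:
  "alternating_multilinear scale sg n
     (\<lambda>zs. crossed_map sg n brg \<rho> \<theta> \<omega> (map fst zs) (map snd zs))"
proof -
  obtain m where n: "n = Suc m"
    using g.n_ge_2 by (cases n) auto
  have "alternating_multilinear sg sg n brg"
    using g.n_lie_bracket by (simp add: n_lie_bracket_def)
  then have brg: "alternating_multilinear scale sg n (\<lambda>zs. brg (map fst zs))"
    by (rule alternating_multilinear_comp_map[OF _ linear_fst])
  have \<omega>: "alternating_multilinear scale sg n (\<lambda>zs. \<omega> (map snd zs))"
    by (rule alternating_multilinear_comp_map[OF omega_alternating linear_snd])
  have "alternating_multilinear scale sg (Suc m)
      (\<lambda>zs. \<Sum>i<Suc m. sg ((-1) ^ i) (\<theta> (snd (zs ! i)) (map fst (omit_nth i zs))))"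
  proof (rule alternating_multilinear_expansion)
    fix zs :: "('g \<times> 'v) list" assume "length zs = m"
    then have "Vector_Spaces.linear sV sg (\<lambda>u. \<theta> u (map fst zs))"
      by (intro theta_linear) (simp add: n)
    from Vector_Spaces.linear_compose[OF linear_snd this]
    show "Vector_Spaces.linear scale sg (\<lambda>z. \<theta> (snd z) (map fst zs))"
      by (simp add: o_def)
  next
    fix z :: "'g \<times> 'v"
    show "alternating_multilinear scale sg m (\<lambda>zs. \<theta> (snd z) (map fst zs))"
      using alternating_multilinear_comp_map[OF theta_alternating linear_fst] by (simp add: n)
  qed
  then have \<theta>: "alternating_multilinear scale sg n
      (\<lambda>zs. \<Sum>i<n. sg ((-1) ^ i) (\<theta> (snd (zs ! i)) (map fst (omit_nth i zs))))"
    by (simp only: n)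
  have "alternating_multilinear scale sg (Suc m)
      (\<lambda>zs. \<Sum>i<Suc m. sg ((-1) ^ i) (\<rho> (map snd (omit_nth i zs)) (fst (zs ! i))))"
  proof (rule alternating_multilinear_expansion)
    fix zs :: "('g \<times> 'v) list" assume "length zs = m"
    then have "Vector_Spaces.linear sg sg (\<rho> (map snd zs))"
      by (intro rho_End) (simp add: n)
    from Vector_Spaces.linear_compose[OF linear_fst this]
    show "Vector_Spaces.linear scale sg (\<lambda>z. \<rho> (map snd zs) (fst z))"
      by (simp add: o_def)
  next
    fix z :: "'g \<times> 'v"
    show "alternating_multilinear scale sg m (\<lambda>zs. \<rho> (map snd zs) (fst z))"
      using alternating_multilinear_comp_map[OF rho_alternating linear_snd] by (simp add: n)
  qed
  then have \<rho>: "alternating_multilinear scale sg n (\<lambda>zs. sg ((-1) ^ m)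
      (\<Sum>i<n. sg ((-1) ^ i) (\<rho> (map snd (omit_nth i zs)) (fst (zs ! i)))))"
    unfolding n by (intro alternating_multilinear_scale g.vector_space_axioms)
  have sign: "(-1 :: 'k) ^ (n - Suc i) = (-1) ^ m * (-1) ^ i" if "i < n" for i
  proof -
    have "(-1 :: 'k) ^ (m - i) * (-1) ^ i = (-1) ^ m"
      using that by (simp add: n flip: power_add)
    then have "(-1 :: 'k) ^ m * (-1) ^ i = (-1) ^ (m - i) * ((-1) ^ i * (-1) ^ i)"
      by (metis mult.assoc)
    also have "\<dots> = (-1) ^ (n - Suc i)"
      by (simp add: n flip: power_mult_distrib)
    finally show ?thesis ..
  qed
  have "alternating_multilinear scale sg n (\<lambda>zs. brg (map fst zs) + \<omega> (map snd zs)
      + (\<Sum>i<n. sg ((-1) ^ i) (\<theta> (snd (zs ! i)) (map fst (omit_nth i zs))))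
      + sg ((-1) ^ m) (\<Sum>i<n. sg ((-1) ^ i) (\<rho> (map snd (omit_nth i zs)) (fst (zs ! i)))))"
    by (intro alternating_multilinear_add brg \<omega> \<theta> \<rho>)
  moreover have "crossed_map sg n brg \<rho> \<theta> \<omega> (map fst zs) (map snd zs) =
      brg (map fst zs) + \<omega> (map snd zs)
      + (\<Sum>i<n. sg ((-1) ^ i) (\<theta> (snd (zs ! i)) (map fst (omit_nth i zs))))
      + sg ((-1) ^ m) (\<Sum>i<n. sg ((-1) ^ i) (\<rho> (map snd (omit_nth i zs)) (fst (zs ! i))))"
    if "length zs = n" for zs
    using that by (simp add: crossed_map_def map_omit_nth g.scale_sum_right sign)
  \<comment> \<open>Agreement on lists of length \<open>n\<close> suffices, because alternation is tested on these.\<close>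
  ultimately show ?thesis
    by (simp add: alternating_multilinear_def)
qed

lemma direct_sum_bracket_alternating:
  "alternating_multilinear scale scale n
     (\<lambda>zs. (crossed_map sg n brg \<rho> \<theta> \<omega> (map fst zs) (map snd zs), brV (map snd zs)))"
proof (rule alternating_multilinear_Pair)
  have "alternating_multilinear sV sV n brV"
    using V.n_lie_bracket by (simp add: n_lie_bracket_def)
  then show "alternating_multilinear scale sV n (\<lambda>zs. brV (map snd zs))"
    by (rule alternating_multilinear_comp_map[OF _ linear_snd])
qed (fact crossed_map_alternating g.vector_space_axioms V.vector_space_axioms)+

end

lemma all_pair_lists_iff:
  fixes P :: "'a list \<Rightarrow> 'b list \<Rightarrow> bool"
  shows "(\<forall>zs. length zs = m \<longrightarrow> P (map fst zs) (map snd zs)) \<longleftrightarrow>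
   (\<forall>xs us. length xs = m \<longrightarrow> length us = m \<longrightarrow> P xs us)"
proof (intro iffI allI impI)
  fix xs :: "'a list" and us :: "'b list"
  assume *: "\<forall>zs. length zs = m \<longrightarrow> P (map fst zs) (map snd zs)"
    and "length xs = m" "length us = m"
  with *[rule_format, of "zip xs us"] show "P xs us" by simp
qed simp

theorem theorem5p2:
  fixes sg :: "'k::field_char_0 \<Rightarrow> 'g::ab_group_add \<Rightarrow> 'g"
    and sV :: "'k \<Rightarrow> 'v::ab_group_add \<Rightarrow> 'v"
    and n :: nat
    and brg :: "'g list \<Rightarrow> 'g"
    and brV :: "'v list \<Rightarrow> 'v"
    and \<rho> :: "'v list \<Rightarrow> 'g \<Rightarrow> 'g"
    and \<theta> :: "'v \<Rightarrow> 'g list \<Rightarrow> 'g"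
    and \<omega> :: "'v list \<Rightarrow> 'g"
    and C :: "'g list \<Rightarrow> 'v list \<Rightarrow> 'g"
  assumes "sparse_crossed_system sg sV n brg brV \<rho> \<theta> \<omega>"
  defines "C \<equiv> crossed_map sg n brg \<rho> \<theta> \<omega>"
  shows "n_lie_bracket (module_prod.scale sg sV) n
           (\<lambda>zs. (C (map fst zs) (map snd zs), brV (map snd zs)))
     \<longleftrightarrow>
     (\<forall>xs us ys vs. length xs = n - 1 \<longrightarrow> length us = n - 1 \<longrightarrow> length ys = n \<longrightarrow> length vs = n \<longrightarrow>
        C (xs @ [C ys vs]) (us @ [brV vs]) =
        (\<Sum>i<n. C (ys[i := C (xs @ [ys ! i]) (us @ [vs ! i])]) (vs[i := brV (us @ [vs ! i])])))"
proof -
  interpret sparse_crossed_system sg sV n brg brV \<rho> \<theta> \<omega> by fact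
  let ?br = "\<lambda>zs. (C (map fst zs) (map snd zs), brV (map snd zs))"
  let ?E = "\<lambda>xs us ys vs. C (xs @ [C ys vs]) (us @ [brV vs]) =
    (\<Sum>i<n. C (ys[i := C (xs @ [ys ! i]) (us @ [vs ! i])]) (vs[i := brV (us @ [vs ! i])]))"
  have "(?br (zs @ [?br ws]) = (\<Sum>i<n. ?br (ws[i := ?br (zs @ [ws ! i])]))) \<longleftrightarrow>
      ?E (map fst zs) (map snd zs) (map fst ws) (map snd ws)"
    if "length zs = n - 1" "length ws = n" for zs ws
  proof -
    \<comment> \<open>The \<open>V\<close>-component of the identity holds, which leaves the \<open>\<gg>\<close>-component.\<close>
    have "brV (map snd zs @ [brV (map snd ws)]) =
        (\<Sum>i<n. brV ((map snd ws)[i := brV (map snd zs @ [map snd ws ! i])]))"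
      using V.n_lie_bracket that by (simp add: n_lie_bracket_def)
    then show ?thesis
      using that by (simp add: sum_prod map_update)
  qed
  then have "n_lie_bracket (module_prod.scale sg sV) n ?br \<longleftrightarrow>
      (\<forall>zs. length zs = n - 1 \<longrightarrow> (\<forall>ws. length ws = n \<longrightarrow>
        ?E (map fst zs) (map snd zs) (map fst ws) (map snd ws)))"
    using direct_sum_bracket_alternating by (auto simp: n_lie_bracket_def C_def)
  also have "\<dots> \<longleftrightarrow> (\<forall>xs us. length xs = n - 1 \<longrightarrow> length us = n - 1 \<longrightarrow>
      (\<forall>ys vs. length ys = n \<longrightarrow> length vs = n \<longrightarrow> ?E xs us ys vs))"
    by (simp only: all_pair_lists_iff[where P = "\<lambda>ys vs. ?E _ _ ys vs"]
        all_pair_lists_iff[where P = "\<lambda>xs us. \<forall>ys vs. length ys = n \<longrightarrow> length vs = n \<longrightarrow> ?E xs us ys vs"])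
  finally show ?thesis by blast
qed

end
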